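(* Let $X,Y$ be normed spaces, $\phi\colon X\times Y\to\overline{\mathbb R}$ a function, $F\colon X\rightrightarrows Y$ a set-valued mapping, and let $\mu(x):=\inf\{\phi(x,y)\mid y\in F(x)\}$ for $x\in X$. Assume that $\mu$ is proper, $\phi$ is an int-nearly convex function, and $F$ is an int-nearly convex set-valued mapping. Suppose further that $$\operatorname{int}(\operatorname{epi}\phi)\cap\operatorname{int}\big((\operatorname{gph}F)\times\mathbb R\big)\neq\emptyset.$$ Then $\mu$ is locally Lipschitz continuous on the interior of its domain $\operatorname{dom}\mu$, and this interior is a nonempty convex set.
   Context: $\overline{\mathbb R}=\mathbb R\cup\{-\infty\}\cup\{\infty\}$ and $\inf\emptyset=\infty$. For $f\colon X\to\overline{\mathbb R}$, $\operatorname{dom}f=\{x\mid f(x)<\infty\}$, $\operatorname{epi}f=\{(x,\lambda)\in X\times\mathbb R\mid f(x)\le\lambda\}$; $f$ is proper if $\operatorname{dom}f\ne\emptyset$ and $f>-\infty$ everywhere. $\operatorname{gph}F=\{(x,y)\mid y\in F(x)\}$. A set $\Omega$ is int-nearly convex if there is a convex set $C$ with $\operatorname{int}C\ne\emptyset$ and $C\subset\Omega\subset\overline C$; a function (resp. set-valued mapping) is int-nearly convex if its epigraph (resp. graph) is. In the displayed condition $(\operatorname{gph}F)\times\mathbb R$ is a subset of $X\times Y\times\mathbb R$. $f$ is locally Lipschitz continuous on an open set if each point of it has a neighborhood on which $f$ is finite and Lipschitz continuous. *)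

theory Defs
  imports "HOL-Analysis.Analysis"
begin

definition eff_dom :: "('a \<Rightarrow> ereal) \<Rightarrow> 'a set" where
  "eff_dom f = {x. f x < \<infinity>}"

text \<open>The library's \<open>epigraph\<close> is for real-valued functions on a set only.\<close>

definition epi :: "('a \<Rightarrow> ereal) \<Rightarrow> ('a \<times> real) set" where
  "epi f = {(x, r). f x \<le> ereal r}"

definition proper_fun :: "('a \<Rightarrow> ereal) \<Rightarrow> bool" where
  "proper_fun f \<longleftrightarrow> eff_dom f \<noteq> {} \<and> (\<forall>x. f x > -\<infinity>)"

definition gph :: "('a \<Rightarrow> 'b set) \<Rightarrow> ('a \<times> 'b) set" where
  "gph F = {(x, y). y \<in> F x}"

definition int_nearly_convex :: "'a::real_normed_vector set \<Rightarrow> bool" where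
  "int_nearly_convex S \<longleftrightarrow>
     (\<exists>C. convex C \<and> interior C \<noteq> {} \<and> C \<subseteq> S \<and> S \<subseteq> closure C)"

definition int_nearly_convex_fun :: "('a::real_normed_vector \<Rightarrow> ereal) \<Rightarrow> bool" where
  "int_nearly_convex_fun f \<longleftrightarrow> int_nearly_convex (epi f)"

definition int_nearly_convex_map ::
  "('a::real_normed_vector \<Rightarrow> 'b::real_normed_vector set) \<Rightarrow> bool" where
  "int_nearly_convex_map F \<longleftrightarrow> int_nearly_convex (gph F)"

text \<open>The infimum over the empty set is \<open>\<infinity>\<close>, the top element of \<^typ>\<open>ereal\<close>.\<close>

definition optimal_value :: "('a \<times> 'b \<Rightarrow> ereal) \<Rightarrow> ('a \<Rightarrow> 'b set) \<Rightarrow> 'a \<Rightarrow> ereal" where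
  "optimal_value \<phi> F x = (INF y\<in>F x. \<phi> (x, y))"

text \<open>Finiteness on \<open>U\<close> is required explicitly because \<^const>\<open>real_of_ereal\<close>
  maps both infinities to \<open>0\<close>.\<close>

definition locally_lipschitz_on :: "'a::metric_space set \<Rightarrow> ('a \<Rightarrow> ereal) \<Rightarrow> bool" where
  "locally_lipschitz_on S f \<longleftrightarrow>
     (\<forall>x\<in>S. \<exists>U. open U \<and> x \<in> U \<and> (\<forall>u\<in>U. \<bar>f u\<bar> \<noteq> \<infinity>) \<and>
        (\<exists>L. L-lipschitz_on U (\<lambda>u. real_of_ereal (f u))))"

end

theory Submission
  imports Defs
begin

text \<open>
  The epigraph of the marginal function \<open>\<mu>\<close> is, up to its boundary, the projection of
  \<open>epi \<phi> \<inter> (gph F \<times> \<real>)\<close> along \<open>Y\<close>: a point \<open>(x, r)\<close> with \<open>\<mu> x < r\<close> is the image of some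
  \<open>((x, y), r)\<close> in this intersection, and a point with \<open>\<mu> x = r\<close> is a limit of such points.
  Int-near convexity survives every operation in this description.  The main tool is the
  accessibility of the interior of a convex set: a segment from an interior point to a point of
  the closure stays in the interior except possibly at its far end.  It shows that an int-nearly
  convex set \<open>S\<close> has a convex interior which is dense in \<open>S\<close>, and from this one obtains
  stability under intersections whose interiors meet (this is where the qualification condition
  enters), under continuous open linear images, and under passage to any set between \<open>S\<close> and
  its closure.  Hence \<open>\<mu>\<close> is an int-nearly convex function
  (\<open>int_nearly_convex_fun_optimal_value\<close>).

  The rest holds for every proper int-nearly convex function \<open>f\<close>.  Its domain is the
  projection of its epigraph, so the interior of the domain is the projection of the interior of
  the epigraph, which is nonempty and convex.  Over it, the interior of the epigraph contains
  every point strictly above the graph (\<open>strict_epi_subset_interior_epi\<close>).  Convexity of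
  \<open>interior (epi f)\<close> then makes \<open>f\<close> an ordinary convex function there, and openness makes \<open>f\<close>
  locally bounded above.  A convex function that is locally bounded above is locally Lipschitz.
\<close>

section \<open>Interior and closure of convex sets in normed spaces\<close>

text \<open>Moving the far end \<open>b\<close> to a nearby \<open>b' \<in> S\<close> is compensated by moving \<open>a\<close> slightly
  inside the interior, so the point of the segment is also a convex combination of points of
  \<open>S\<close>, one of which is interior.\<close>

lemma convex_closure_interior_segment:
  fixes S :: "'a::real_normed_vector set"
  assumes "convex S" and a: "a \<in> interior S" and b: "b \<in> closure S" and t: "0 < t" "t \<le> 1"
  shows "(1 - t) *\<^sub>R b + t *\<^sub>R a \<in> interior S"
proof -
  \<comment> \<open>\<open>h z\<close> replaces \<open>a\<close> when \<open>z\<close> replaces \<open>b\<close>\<close>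
  define h where "h z = a + ((1 - t) / t) *\<^sub>R (b - z)" for z
  have "open (h -` interior S)"
    unfolding h_def by (intro open_vimage open_interior continuous_intros)
  moreover have "b \<in> h -` interior S"
    using a by (simp add: h_def)
  ultimately obtain b' where b': "b' \<in> S" "h b' \<in> interior S"
    using b by (meson closure_iff_nhds_not_empty disjoint_iff vimageD order_refl)
  have p: "(1 - t) *\<^sub>R b + t *\<^sub>R a = (1 - t) *\<^sub>R b' + t *\<^sub>R h b'"
  proof -
    have "t *\<^sub>R h b' = t *\<^sub>R a + (1 - t) *\<^sub>R (b - b')"
      using t by (simp add: h_def scaleR_add_right)
    then show ?thesis
      by (simp add: algebra_simps)
  qed
  let ?A = "(\<lambda>z. (1 - t) *\<^sub>R b' + z) ` (\<lambda>z. t *\<^sub>R z) ` interior S"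
  have "open ?A"
    using t by (intro open_translation open_scaling) auto
  moreover have "?A \<subseteq> S"
  proof clarify
    fix z assume "z \<in> interior S"
    then have "z \<in> S"
      using interior_subset by blast
    then show "(1 - t) *\<^sub>R b' + t *\<^sub>R z \<in> S"
      using b'(1) t by (intro convexD[OF \<open>convex S\<close>]) auto
  qed
  moreover have "(1 - t) *\<^sub>R b + t *\<^sub>R a \<in> ?A"
    using b'(2) p by auto
  ultimately show ?thesis
    by (meson interiorI)
qed

lemma limit_at_right_in_closure:
  fixes g :: "real \<Rightarrow> 'a::topological_space"
  assumes "(g \<longlongrightarrow> l) (at_right 0)" and "\<And>t. 0 < t \<Longrightarrow> t \<le> 1 \<Longrightarrow> g t \<in> S"
  shows "l \<in> closure S"
proof (rule Lim_in_closed_set[OF closed_closure _ _ assms(1)])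
  show "\<forall>\<^sub>F t in at_right 0. g t \<in> closure S"
    unfolding eventually_at_right_field
    using assms(2) closure_subset[of S] by (intro exI[of _ 1]) (simp add: subset_iff)
qed simp

lemma convex_subset_closure_interior:
  fixes S :: "'a::real_normed_vector set"
  assumes "convex S" "interior S \<noteq> {}"
  shows "closure S \<subseteq> closure (interior S)"
proof
  fix b assume b: "b \<in> closure S"
  obtain a where a: "a \<in> interior S"
    using assms(2) by blast
  let ?p = "\<lambda>t. (1 - t) *\<^sub>R b + t *\<^sub>R a"
  have "(?p \<longlongrightarrow> (1 - 0) *\<^sub>R b + 0 *\<^sub>R a) (at_right 0)"
    by (intro tendsto_intros)
  then have "(?p \<longlongrightarrow> b) (at_right 0)"
    by simp
  then show "b \<in> closure (interior S)"
    using convex_closure_interior_segment[OF assms(1) a b] by (rule limit_at_right_in_closure)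
qed

text \<open>An interior point of the closure can be pushed a little further away from an interior
  point of the set without leaving the closure; accessibility then applies to it.\<close>

lemma convex_interior_closure_subset:
  fixes S :: "'a::real_normed_vector set"
  assumes "convex S" "interior S \<noteq> {}"
  shows "interior (closure S) \<subseteq> interior S"
proof
  fix x assume x: "x \<in> interior (closure S)"
  obtain a where a: "a \<in> interior S"
    using assms(2) by blast
  let ?q = "\<lambda>s. x + s *\<^sub>R (x - a)"
  have "(?q \<longlongrightarrow> x + 0 *\<^sub>R (x - a)) (at_right 0)"
    by (intro tendsto_intros)
  then have "\<forall>\<^sub>F s in at_right (0::real). ?q s \<in> interior (closure S)"
    using x by (intro topological_tendstoD) auto
  then obtain s where s: "s > 0" "?q s \<in> closure S"
    by (metis (no_types, lifting) eventually_at_right_field field_lbound_gt_zero interior_subset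
        subsetD zero_less_one)
  let ?t = "s / (1 + s)"
  have "(1 - ?t) *\<^sub>R ?q s + ?t *\<^sub>R a \<in> interior S"
    using convex_closure_interior_segment[OF assms(1) a s(2), of ?t] s by simp
  moreover have "(1 - ?t) *\<^sub>R ?q s + ?t *\<^sub>R a = x"
  proof -
    have e: "1 - ?t = 1 / (1 + s)"
      using s by (simp add: field_simps)
    have "(1 - ?t) *\<^sub>R ?q s + ?t *\<^sub>R a = (1 / (1 + s)) *\<^sub>R (?q s + s *\<^sub>R a)"
      unfolding e by (simp add: scaleR_add_right)
    also have "\<dots> = (1 / (1 + s)) *\<^sub>R ((1 + s) *\<^sub>R x)"
      by (simp add: algebra_simps)
    finally show ?thesis
      using s by simp
  qed
  ultimately show "x \<in> interior S"
    by simp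
qed

section \<open>Calculus of int-nearly convex sets\<close>

lemma int_nearly_convexI:
  assumes "convex C" "interior C \<noteq> {}" "C \<subseteq> S" "S \<subseteq> closure C"
  shows "int_nearly_convex S"
  using assms unfolding int_nearly_convex_def by blast

text \<open>The convex set squeezing \<open>S\<close> has the same interior as its closure, hence as \<open>S\<close>; so the
  interior of \<open>S\<close> may itself serve as the convex core.\<close>

lemma int_nearly_convexD:
  assumes "int_nearly_convex S"
  shows "convex (interior S)" "interior S \<noteq> {}" "S \<subseteq> closure (interior S)"
proof -
  obtain C where C: "convex C" "interior C \<noteq> {}" "C \<subseteq> S" "S \<subseteq> closure C"
    using assms unfolding int_nearly_convex_def by blast
  have eq: "interior S = interior C"
    using C convex_interior_closure_subset interior_mono by blast
  show "convex (interior S)" "interior S \<noteq> {}" "S \<subseteq> closure (interior S)"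
    using C convex_subset_closure_interior[of C] unfolding eq by auto
qed

lemma int_nearly_convex_UNIV: "int_nearly_convex UNIV"
  by (rule int_nearly_convexI[of UNIV]) auto

lemma int_nearly_convex_Times:
  assumes "int_nearly_convex S" "int_nearly_convex T"
  shows "int_nearly_convex (S \<times> T)"
  by (rule int_nearly_convexI[of "interior S \<times> interior T"])
    (use int_nearly_convexD[OF assms(1)] int_nearly_convexD[OF assms(2)]
      interior_subset[of S] interior_subset[of T] in
      \<open>auto simp: convex_Times closure_Times interior_Times\<close>)

lemma int_nearly_convex_between:
  assumes "int_nearly_convex S" "S \<subseteq> T" "T \<subseteq> closure S"
  shows "int_nearly_convex T"
proof (rule int_nearly_convexI[of "interior S"])
  have "closure S \<subseteq> closure (interior S)"
    using int_nearly_convexD(3)[OF assms(1)] by (simp add: closure_minimal)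
  then show "T \<subseteq> closure (interior S)"
    using assms(3) by blast
qed (use assms int_nearly_convexD[OF assms(1)] interior_subset[of S] in auto)

text \<open>A common interior point \<open>q\<close> sees every \<open>p \<in> S \<inter> T\<close> along a segment whose
  points other than \<open>p\<close> are interior to both sets.\<close>

lemma int_nearly_convex_Int:
  assumes S: "int_nearly_convex S" and T: "int_nearly_convex T"
    and ne: "interior S \<inter> interior T \<noteq> {}"
  shows "int_nearly_convex (S \<inter> T)"
proof (rule int_nearly_convexI[of "interior S \<inter> interior T"])
  note SD = int_nearly_convexD[OF S] and TD = int_nearly_convexD[OF T]
  show "S \<inter> T \<subseteq> closure (interior S \<inter> interior T)"
  proof
    fix p assume p: "p \<in> S \<inter> T"
    obtain q where q: "q \<in> interior S \<inter> interior T"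
      using ne by blast
    let ?p = "\<lambda>t. (1 - t) *\<^sub>R p + t *\<^sub>R q"
    have "(?p \<longlongrightarrow> (1 - 0) *\<^sub>R p + 0 *\<^sub>R q) (at_right 0)"
      by (intro tendsto_intros)
    then have "(?p \<longlongrightarrow> p) (at_right 0)"
      by simp
    moreover have "?p t \<in> interior S \<inter> interior T" if "0 < t" "t \<le> 1" for t
      using convex_closure_interior_segment[OF SD(1), of q p t] q p SD(3) TD(3) that
        convex_closure_interior_segment[OF TD(1), of q p t] by auto
    ultimately show "p \<in> closure (interior S \<inter> interior T)"
      by (rule limit_at_right_in_closure)
  qed
  show "convex (interior S \<inter> interior T)"
    using SD(1) TD(1) by (rule convex_Int)
  show "interior (interior S \<inter> interior T) \<noteq> {}"
    using ne by (simp add: interior_open open_Int)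
  show "interior S \<inter> interior T \<subseteq> S \<inter> T"
    using interior_subset[of S] interior_subset[of T] by blast
qed

text \<open>The open convex set \<open>h ` interior S\<close> is dense in \<open>h ` S\<close>, so \<open>h ` S\<close> has no interior
  points beyond it.\<close>

lemma
  assumes h: "bounded_linear h" and op: "\<And>U. open U \<Longrightarrow> open (h ` U)"
    and S: "int_nearly_convex S"
  shows interior_open_linear_image: "interior (h ` S) = h ` interior S"
    and int_nearly_convex_open_linear_image: "int_nearly_convex (h ` S)"
proof -
  note SD = int_nearly_convexD[OF S]
  let ?U = "h ` interior S"
  have U: "open ?U" "convex ?U" "?U \<noteq> {}" "?U \<subseteq> h ` S"
    using op SD h interior_subset[of S]
    by (auto intro: convex_linear_image bounded_linear.linear)
  have "h ` closure (interior S) \<subseteq> closure ?U"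
    using h by (intro image_closure_subset linear_continuous_on closure_subset closed_closure)
  then have dense: "h ` S \<subseteq> closure ?U"
    using SD(3) by blast
  show "int_nearly_convex (h ` S)"
    using U dense by (intro int_nearly_convexI[of ?U]) (auto simp: interior_open)
  have "interior (h ` S) \<subseteq> interior (closure ?U)"
    using dense by (rule interior_mono)
  also have "\<dots> \<subseteq> ?U"
    using convex_interior_closure_subset[of ?U] U by (simp add: interior_open)
  finally show "interior (h ` S) = ?U"
    using U interior_maximal by blast
qed

lemma open_fst_image:
  fixes U :: "('a::topological_space \<times> 'b::topological_space) set"
  assumes "open U"
  shows "open (fst ` U)"
proof -
  have "fst ` U = (\<Union>y. (\<lambda>x. (x, y)) -` U)"
    by force
  then show ?thesis
    using assms by (auto intro!: open_vimage continuous_intros)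
qed

lemma open_map_prod_fst_image:
  fixes U :: "(('a::topological_space \<times> 'b::topological_space) \<times> 'c::topological_space) set"
  assumes "open U"
  shows "open (map_prod fst id ` U)"
proof -
  have "map_prod fst id ` U = (\<Union>y. (\<lambda>(x, r). ((x, y), r)) -` U)"
    by (force simp: image_iff)
  then show ?thesis
    using assms by (auto intro!: open_vimage continuous_intros simp: case_prod_beta)
qed

section \<open>Int-near convexity of the marginal function\<close>

text \<open>The projection of \<open>epi \<phi> \<inter> (gph F \<times> \<real>)\<close> may miss points of the graph of the marginal
  function, since infima need not be attained; the squeeze between a set and its closure in the
  notion of int-near convexity absorbs exactly this defect.\<close>

theorem int_nearly_convex_fun_optimal_value:
  fixes \<phi> :: "'a::real_normed_vector \<times> 'b::real_normed_vector \<Rightarrow> ereal"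
    and F :: "'a \<Rightarrow> 'b set"
  assumes \<phi>: "int_nearly_convex_fun \<phi>" and F: "int_nearly_convex_map F"
    and ne: "interior (epi \<phi>) \<inter> interior (gph F \<times> (UNIV :: real set)) \<noteq> {}"
  shows "int_nearly_convex_fun (optimal_value \<phi> F)"
proof -
  let ?h = "map_prod fst id :: ('a \<times> 'b) \<times> real \<Rightarrow> 'a \<times> real"
  let ?S = "epi \<phi> \<inter> gph F \<times> (UNIV :: real set)"
  have "int_nearly_convex ?S"
    using int_nearly_convex_Times[OF _ int_nearly_convex_UNIV] \<phi> F ne
    unfolding int_nearly_convex_fun_def int_nearly_convex_map_def
    by (intro int_nearly_convex_Int) auto
  moreover have "bounded_linear ?h"
    unfolding map_prod_def case_prod_beta id_apply
    by (intro bounded_linear_Pair bounded_linear_compose[OF bounded_linear_fst bounded_linear_fst]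
        bounded_linear_snd)
  ultimately have inc: "int_nearly_convex (?h ` ?S)"
    using int_nearly_convex_open_linear_image open_map_prod_fst_image by blast
  have "?h ` ?S \<subseteq> epi (optimal_value \<phi> F)"
    unfolding epi_def gph_def optimal_value_def by (auto intro: INF_lower2)
  moreover have "epi (optimal_value \<phi> F) \<subseteq> closure (?h ` ?S)"
  proof clarify
    fix x r assume "(x, r) \<in> epi (optimal_value \<phi> F)"
    then have le: "optimal_value \<phi> F x \<le> ereal r"
      by (simp add: epi_def)
    \<comment> \<open>the infimum need not be attained at height \<open>r\<close>, but it is undercut at every height above\<close>
    have "(x, r + e) \<in> ?h ` ?S" if "e > 0" for e
    proof -
      have "optimal_value \<phi> F x < ereal (r + e)"
        using le that by (simp add: le_less_trans)
      then obtain y where "y \<in> F x" "\<phi> (x, y) < ereal (r + e)"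
        unfolding optimal_value_def INF_less_iff by blast
      then have "((x, y), r + e) \<in> ?S"
        by (simp add: epi_def gph_def less_imp_le)
      then show ?thesis
        by force
    qed
    moreover have "((\<lambda>e. (x, r + e)) \<longlongrightarrow> (x, r + 0)) (at_right 0)"
      by (intro tendsto_intros)
    then have "((\<lambda>e. (x, r + e)) \<longlongrightarrow> (x, r)) (at_right 0)"
      by simp
    ultimately show "(x, r) \<in> closure (?h ` ?S)"
      by (intro limit_at_right_in_closure)
  qed
  ultimately show ?thesis
    unfolding int_nearly_convex_fun_def by (rule int_nearly_convex_between[OF inc])
qed

section \<open>Lipschitz continuity of int-nearly convex functions\<close>

text \<open>A bound above on a ball gives a two-sided bound \<open>M\<close> by reflection in the centre.  For
  \<open>u\<close>, \<open>v\<close> in the ball of half the radius, prolonging the segment from \<open>u\<close> to \<open>v\<close> by \<open>e / 2\<close>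
  stays in the ball, and convexity along it bounds the slope by \<open>2 M / (e / 2)\<close>.\<close>

lemma convex_on_bounded_above_imp_lipschitz:
  fixes f :: "'a::real_normed_vector \<Rightarrow> real"
  assumes cvx: "convex_on (cball x e) f" and e: "e > 0"
    and bd: "\<And>y. y \<in> cball x e \<Longrightarrow> f y \<le> b"
  shows "\<exists>L. L-lipschitz_on (ball x (e / 2)) f"
proof -
  define M where "M = b + 2 * \<bar>f x\<bar>"
  have M: "\<bar>f y\<bar> \<le> M" if "y \<in> cball x e" for y
    using convex_bounds_lemma[OF cvx bd that] by (simp add: M_def)
  have M0: "M \<ge> 0"
    using M[of x] e by auto
  have slope: "f v - f u \<le> 4 * M / e * dist u v"
    if u: "u \<in> ball x (e / 2)" and v: "v \<in> ball x (e / 2)" for u v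
  proof (cases "u = v")
    case False
    define n where "n = dist u v"
    have n: "n > 0"
      using False by (simp add: n_def)
    define w where "w = v + (e / 2 / n) *\<^sub>R (v - u)"
    define l where "l = n / (n + e / 2)"
    have l: "0 \<le> l" "l \<le> 1"
      using n e by (auto simp: l_def)
    have "dist v w = e / 2"
      using n e by (simp add: w_def n_def dist_norm norm_minus_commute)
    then have w: "w \<in> cball x e"
      using v dist_triangle[of x w v] by (auto simp: mem_ball)
    have ux: "u \<in> cball x e"
      using u e by auto
    have "v = (1 - l) *\<^sub>R u + l *\<^sub>R w"
    proof -
      have "1 + e / 2 / n = (n + e / 2) / n" "n + e / 2 \<noteq> 0"
        using n e by (auto simp: add_divide_distrib)
      then have "l * (1 + e / 2 / n) = 1"
        using n by (simp add: l_def)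
      then have "l *\<^sub>R (w - u) = v - u"
        unfolding w_def
        by (metis (no_types, lifting) add_diff_eq add.commute diff_add_eq scaleR_add_left
            scaleR_one scaleR_scaleR)
      then show ?thesis
        by (simp add: algebra_simps)
    qed
    then have "f v \<le> (1 - l) * f u + l * f w"
      using convex_onD[OF cvx, of l u w] l ux w by simp
    then have "f v - f u \<le> l * (f w - f u)"
      by (simp add: algebra_simps)
    also have "\<dots> \<le> l * (2 * M)"
      using M[OF w] M[OF ux] l by (intro mult_left_mono) auto
    also have "\<dots> \<le> n / (e / 2) * (2 * M)"
      using n e M0 unfolding l_def by (intro mult_right_mono divide_left_mono) auto
    also have "\<dots> = 4 * M / e * dist u v"
      by (simp add: n_def)
    finally show ?thesis .
  qed simp
  have "(4 * M / e)-lipschitz_on (ball x (e / 2)) f"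
  proof (rule lipschitz_onI)
    fix u v assume "u \<in> ball x (e / 2)" "v \<in> ball x (e / 2)"
    then show "dist (f u) (f v) \<le> 4 * M / e * dist u v"
      using slope[of u v] slope[of v u] by (auto simp: dist_real_def dist_commute)
  qed (use M0 e in simp)
  then show ?thesis
    by blast
qed

lemma eff_dom_eq_fst_epi: "eff_dom f = fst ` epi f"
proof
  show "eff_dom f \<subseteq> fst ` epi f"
  proof
    fix x assume "x \<in> eff_dom f"
    then obtain r where "f x < ereal r"
      unfolding eff_dom_def using ereal_dense2 by blast
    then have "(x, r) \<in> epi f"
      by (simp add: epi_def)
    then show "x \<in> fst ` epi f"
      by force
  qed
qed (auto simp: eff_dom_def epi_def intro: le_less_trans)

lemma
  fixes f :: "'a::real_normed_vector \<Rightarrow> ereal"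
  assumes "int_nearly_convex_fun f"
  shows int_nearly_convex_eff_dom: "int_nearly_convex (eff_dom f)"
    and interior_eff_dom: "interior (eff_dom f) = fst ` interior (epi f)"
  using assms int_nearly_convex_open_linear_image[OF bounded_linear_fst open_fst_image]
    interior_open_linear_image[OF bounded_linear_fst open_fst_image]
  unfolding eff_dom_eq_fst_epi int_nearly_convex_fun_def by blast+

text \<open>The vertical line over \<open>x\<close> meets the interior of the epigraph at some height \<open>r\<^sub>0\<close>.  Any
  other height \<open>r\<close> strictly above \<open>f x\<close> lies strictly between \<open>r\<^sub>0\<close> and the height of some
  other point of the epigraph, so it is accessible from \<open>(x, r\<^sub>0)\<close>.\<close>

lemma strict_epi_subset_interior_epi:
  fixes f :: "'a::real_normed_vector \<Rightarrow> ereal"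
  assumes f: "int_nearly_convex_fun f" and x: "x \<in> interior (eff_dom f)" and r: "f x < ereal r"
  shows "(x, r) \<in> interior (epi f)"
proof -
  have epi: "int_nearly_convex (epi f)"
    using f by (simp add: int_nearly_convex_fun_def)
  obtain r0 where r0: "(x, r0) \<in> interior (epi f)"
    using x interior_eff_dom[OF f] by force
  obtain s where s: "f x \<le> ereal s" and between: "r0 \<le> r \<and> r < s \<or> s < r \<and> r < r0"
  proof (cases "r0 \<le> r")
    case True
    have "f x \<le> ereal (r + 1)"
      using r by (rule order_trans[OF less_imp_le]) simp
    then show ?thesis
      using that[of "r + 1"] True by simp
  next
    case False
    obtain s where "f x < ereal s" "ereal s < ereal r"
      using ereal_dense2[OF r] by blast
    then show ?thesis
      using that[of s] False by simp
  qed
  define t where "t = (s - r) / (s - r0)"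
  have t: "0 < t" "t \<le> 1"
    using between by (auto simp: t_def zero_less_divide_iff divide_le_eq_1)
  have "t * (s - r0) = s - r"
    using between by (auto simp: t_def)
  then have eq: "(1 - t) * s + t * r0 = r"
    by (simp add: algebra_simps)
  have "(x, s) \<in> closure (interior (epi f))"
    using s int_nearly_convexD(3)[OF epi] by (auto simp: epi_def)
  then have "(1 - t) *\<^sub>R (x, s) + t *\<^sub>R (x, r0) \<in> interior (epi f)"
    using convex_closure_interior_segment[OF int_nearly_convexD(1)[OF epi], of "(x, r0)" "(x, s)"]
      r0 t by simp
  moreover have "(1 - t) *\<^sub>R (x, s) + t *\<^sub>R (x, r0) = (x, r)"
    using eq by (simp add: algebra_simps)
  ultimately show ?thesis
    by simp
qed

text \<open>The graph itself lies on the boundary of the epigraph, where convexity may fail, so the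
  convexity inequality is read off from the points at height \<open>f x + \<epsilon>\<close>, letting \<open>\<epsilon>\<close> tend to
  \<open>0\<close> at the end.\<close>

lemma convex_on_interior_eff_dom:
  fixes f :: "'a::real_normed_vector \<Rightarrow> ereal"
  assumes f: "int_nearly_convex_fun f" and fin: "\<And>x. x \<in> interior (eff_dom f) \<Longrightarrow> \<bar>f x\<bar> \<noteq> \<infinity>"
  shows "convex_on (interior (eff_dom f)) (\<lambda>x. real_of_ereal (f x))"
proof -
  let ?Q = "interior (eff_dom f)" and ?g = "\<lambda>x. real_of_ereal (f x)"
  have cQ: "convex ?Q"
    by (rule int_nearly_convexD(1)[OF int_nearly_convex_eff_dom[OF f]])
  have cP: "convex (interior (epi f))"
    using f int_nearly_convexD(1) unfolding int_nearly_convex_fun_def by blast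
  have "?g (u *\<^sub>R x + v *\<^sub>R y) \<le> u * ?g x + v * ?g y"
    if x: "x \<in> ?Q" and y: "y \<in> ?Q" and uv: "0 \<le> u" "0 \<le> v" "u + v = 1" for x y u v
  proof (rule field_le_epsilon)
    fix e :: real assume e: "e > 0"
    let ?z = "u *\<^sub>R x + v *\<^sub>R y"
    have P: "(p, ?g p + e) \<in> interior (epi f)" if "p \<in> ?Q" for p
      using strict_epi_subset_interior_epi[OF f that, of "?g p + e"] fin[OF that] e
      by (cases "f p") auto
    have "u *\<^sub>R (x, ?g x + e) + v *\<^sub>R (y, ?g y + e) \<in> epi f"
      using convexD[OF cP P[OF x] P[OF y] uv] interior_subset by blast
    then have "f ?z \<le> ereal (u * (?g x + e) + v * (?g y + e))"
      by (simp add: epi_def)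
    moreover have "?z \<in> ?Q"
      using convexD[OF cQ x y uv] .
    ultimately have "?g ?z \<le> u * (?g x + e) + v * (?g y + e)"
      using fin[of ?z] by (cases "f ?z") auto
    also have "\<dots> = u * ?g x + v * ?g y + (u + v) * e"
      by (simp add: algebra_simps)
    finally show "?g ?z \<le> u * ?g x + v * ?g y + e"
      using uv by simp
  qed
  then show ?thesis
    using cQ by (simp add: convex_on_def)
qed

text \<open>An interior point \<open>(x, r)\<close> of the epigraph has a neighbourhood in the epigraph, whose slice
  at height \<open>r\<close> is a neighbourhood of \<open>x\<close> on which \<open>r\<close> bounds \<open>f\<close> from above.\<close>

theorem locally_lipschitz_on_interior_eff_dom:
  fixes f :: "'a::real_normed_vector \<Rightarrow> ereal"
  assumes f: "int_nearly_convex_fun f" and proper: "proper_fun f"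
  shows "locally_lipschitz_on (interior (eff_dom f)) f"
  unfolding locally_lipschitz_on_def
proof
  let ?Q = "interior (eff_dom f)" and ?g = "\<lambda>x. real_of_ereal (f x)"
  fix x assume x: "x \<in> ?Q"
  have fin: "\<bar>f y\<bar> \<noteq> \<infinity>" if "y \<in> ?Q" for y
    using that proper interior_subset[of "eff_dom f"]
    unfolding proper_fun_def eff_dom_def by (cases "f y") (force dest: spec[of _ y])+
  obtain r where r: "(x, r) \<in> interior (epi f)"
    using x interior_eff_dom[OF f] by force
  let ?V = "?Q \<inter> (\<lambda>y. (y, r)) -` interior (epi f)"
  have "open ?V"
    by (intro open_Int open_interior open_vimage continuous_intros)
  moreover have "x \<in> ?V"
    using x r by simp
  ultimately obtain e where e: "e > 0" "cball x e \<subseteq> ?V"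
    by (meson open_contains_cball)
  have "convex_on (cball x e) ?g"
    using e(2) by (intro convex_on_subset[OF convex_on_interior_eff_dom[OF f fin]]) auto
  moreover have "?g y \<le> r" if "y \<in> cball x e" for y
  proof -
    have "y \<in> ?Q" "(y, r) \<in> epi f"
      using that e(2) interior_subset[of "epi f"] by auto
    then show ?thesis
      using fin[of y] by (cases "f y") (auto simp: epi_def)
  qed
  ultimately obtain L where L: "L-lipschitz_on (ball x (e / 2)) ?g"
    using convex_on_bounded_above_imp_lipschitz[OF _ e(1)] by blast
  have "ball x (e / 2) \<subseteq> ?Q"
    using e by force
  then have "\<forall>u\<in>ball x (e / 2). \<bar>f u\<bar> \<noteq> \<infinity>"
    by (intro ballI fin) (rule subsetD)
  then show "\<exists>U. open U \<and> x \<in> U \<and> (\<forall>u\<in>U. \<bar>f u\<bar> \<noteq> \<infinity>) \<and> (\<exists>L. L-lipschitz_on U ?g)"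
    using L e(1) by (intro exI[of _ "ball x (e / 2)"] conjI) auto
qed

theorem proposition4p12:
  fixes \<phi> :: "'a::real_normed_vector \<times> 'b::real_normed_vector \<Rightarrow> ereal"
    and F :: "'a \<Rightarrow> 'b set"
  assumes "proper_fun (optimal_value \<phi> F)"
    and "int_nearly_convex_fun \<phi>"
    and "int_nearly_convex_map F"
    and "interior (epi \<phi>) \<inter> interior (gph F \<times> (UNIV :: real set)) \<noteq> {}"
  shows "locally_lipschitz_on (interior (eff_dom (optimal_value \<phi> F))) (optimal_value \<phi> F)
    \<and> interior (eff_dom (optimal_value \<phi> F)) \<noteq> {}
    \<and> convex (interior (eff_dom (optimal_value \<phi> F)))"
proof -
  have \<mu>: "int_nearly_convex_fun (optimal_value \<phi> F)"
    using assms(2-4) by (rule int_nearly_convex_fun_optimal_value)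
  show ?thesis
    using locally_lipschitz_on_interior_eff_dom[OF \<mu> assms(1)]
      int_nearly_convexD[OF int_nearly_convex_eff_dom[OF \<mu>]] by blast
qed

end
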